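(* Let $n\ge3$ be an integer. For $x>0$ and $\lambda_1,\lambda_2,\lambda_3\ge0$, $$\mathcal{R}_{n,3}(x,\lambda_1,\lambda_2,\lambda_3)=\frac{(n-2)\,x^{3n-4}\,e^{-3x}}{n\,(n-1)^2\,(n-2)^3}\;\det\begin{pmatrix}{}_0F_1(n-2;x\lambda_1)&{}_0F_1(n-2;x\lambda_2)&{}_0F_1(n-2;x\lambda_3)\\ G_{n-1,2}(x,\lambda_1)&G_{n-1,2}(x,\lambda_2)&G_{n-1,2}(x,\lambda_3)\\ G_{n,3}(x,\lambda_1)&G_{n,3}(x,\lambda_2)&G_{n,3}(x,\lambda_3)\end{pmatrix}.$$
   Context: For a positive integer $a$, ${}_0F_1(a;z)=\sum_{k=0}^\infty \frac{z^k}{(a)_k\,k!}$ with $(a)_k=a(a+1)\cdots(a+k-1)$. For integers $k\ge 0$, $a\ge1$, put $$H^k_a(x,y)=\int_0^x t^k e^{-t}\,{}_0F_1(a;ty)\,dt .$$ For an integer $n\ge3$ define $$\mathcal{R}_{n,3}(x,\lambda_1,\lambda_2,\lambda_3)=\frac{\partial}{\partial x}\det\Big(H^{n-j}_{n-2}(x,\lambda_i)\Big)_{i,j=1}^3 ,$$ where $i$ is the row index and $j$ the column index. For integers $n\ge 2$ define $$G_{n,2}(x,y)=n\,{}_0F_1(n;xy)+y\,{}_0F_1(n+1;xy)+(x-y-n+1)\,e^{y}\int_y^\infty e^{-t}\,{}_0F_1(n+1;xt)\,dt ,$$ and $$G_{n,3}(x,y)=\Big(-y\frac{\partial^2}{\partial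 y^2}-(n-1)\frac{\partial}{\partial y}+x+2\Big)G_{n,2}(x,y).$$ *)

theory Defs
  imports "HOL-Analysis.Analysis"
begin

text \<open>The confluent hypergeometric limit function, for a positive integer parameter \<open>a\<close>.\<close>

definition hyp0F1 :: "nat \<Rightarrow> real \<Rightarrow> real" where
  "hyp0F1 a z = (\<Sum>k. z ^ k / (pochhammer (real a) k * fact k))"

text \<open>\<open>H k a x y\<close> is $H^k_a(x,y)$; it is only meaningful for \<open>x \<ge> 0\<close>, since the
  Henstock--Kurzweil integral over \<open>{0..x}\<close> is not oriented.\<close>

definition H :: "nat \<Rightarrow> nat \<Rightarrow> real \<Rightarrow> real \<Rightarrow> real" where
  "H k a x y = integral {0..x} (\<lambda>t. t ^ k * exp (- t) * hyp0F1 a (t * y))"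

text \<open>The index differences below are truncated subtractions on \<open>nat\<close>; they are exact for
  \<open>n \<ge> 3\<close>.\<close>

definition R3 :: "nat \<Rightarrow> real \<Rightarrow> real \<Rightarrow> real \<Rightarrow> real \<Rightarrow> real" where
  "R3 n x l1 l2 l3 =
     deriv (\<lambda>x. det (vector
       [vector [H (n - 1) (n - 2) x l1, H (n - 2) (n - 2) x l1, H (n - 3) (n - 2) x l1],
        vector [H (n - 1) (n - 2) x l2, H (n - 2) (n - 2) x l2, H (n - 3) (n - 2) x l2],
        vector [H (n - 1) (n - 2) x l3, H (n - 2) (n - 2) x l3, H (n - 3) (n - 2) x l3]]
       :: real ^ 3 ^ 3)) x"

definition G2 :: "nat \<Rightarrow> real \<Rightarrow> real \<Rightarrow> real" where
  "G2 n x y = real n * hyp0F1 n (x * y) + y * hyp0F1 (n + 1) (x * y)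
     + (x - y - real n + 1) * exp y
       * integral {y..} (\<lambda>t. exp (- t) * hyp0F1 (n + 1) (x * t))"

text \<open>The formula for \<open>G2 n x y\<close> makes sense for every real \<open>y\<close>, so the derivatives in \<open>y\<close> are
  two-sided also at \<open>y = 0\<close>.\<close>

definition G3 :: "nat \<Rightarrow> real \<Rightarrow> real \<Rightarrow> real" where
  "G3 n x y = - y * deriv (deriv (\<lambda>y. G2 n x y)) y
     - (real n - 1) * deriv (\<lambda>y. G2 n x y) y + (x + 2) * G2 n x y"

end

theory Submission
  imports Defs
begin

text \<open>
  Put \<open>a = n - 2\<close>, so that the columns of the matrix under the derivative are \<open>H (a + 1) a\<close>,
  \<open>H a a\<close> and \<open>H (a - 1) a\<close>. Differentiating in \<open>x\<close> turns one column at a time into the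
  integrand, that is into a power of \<open>x\<close> times \<open>x ^ (n - 3) * exp (- x) * f\<close> with
  \<open>f = hyp0F1 a (x * y)\<close>. The three resulting determinants recombine into a single one with
  columns \<open>f\<close>, \<open>H (a + 1) a - x * H a a\<close> and \<open>H a a - x * H (a - 1) a\<close>
  (\<open>R3_eq_sum_det\<close>, \<open>det_row_operations\<close>).

  Both of these combinations are expressible through \<open>G2\<close> and \<open>G3\<close>. The second one is a multiple
  of \<open>G2 (n - 1)\<close>, with a factor independent of \<open>y\<close> (\<open>H_combination_G2\<close>); the first one is
  such a multiple of \<open>G3 n - n * G2 (n - 1)\<close> (\<open>H_combination_G3\<close>), and the term
  \<open>n * G2 (n - 1)\<close> disappears in the determinant because it is proportional to the other column.

  These two identities rest on the fact that the integral from \<open>0\<close> to \<open>x\<close> in \<open>H (a - 1) a\<close> and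
  the integral from \<open>y\<close> to infinity in \<open>G2\<close> are the same function up to an elementary factor
  (\<open>H_eq_exp_tail\<close>). Both satisfy the same first order equation in \<open>y\<close>, and the solution is
  pinned down by its decay at infinity. Once this is known, integration by parts and the contiguous
  relation of \<open>hyp0F1\<close> reduce every \<open>H k a\<close> to one tail integral and two values of
  \<open>hyp0F1\<close> with adjacent parameters, and the identities become polynomial ones. The derivatives
  of \<open>G2\<close> in \<open>y\<close> that occur in \<open>G3\<close> are equally simple: \<open>G2\<close> minus its
  tail integral is the derivative of \<open>G2\<close>.
\<close>

section \<open>The confluent hypergeometric limit function\<close>

lemma hyp0F1_term_bound:
  assumes "a > 0"
  shows "\<bar>z ^ k / (pochhammer (real a) k * fact k)\<bar> \<le> \<bar>z\<bar> ^ k / (fact k * fact k)"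
proof -
  have "pochhammer 1 k \<le> pochhammer (real a) k"
    unfolding pochhammer_prod using assms by (intro prod_mono) auto
  then have "fact k \<le> pochhammer (real a) k"
    by (simp add: pochhammer_fact[symmetric])
  then have "fact k * fact k \<le> pochhammer (real a) k * (fact k :: real)"
    by (intro mult_right_mono) auto
  then show ?thesis
    using assms by (simp add: abs_mult power_abs pochhammer_nonneg frac_le)
qed

lemma hyp0F1_term_summable:
  assumes "a > 0"
  shows "summable (\<lambda>k. z ^ k / (pochhammer (real a) k * fact k))"
proof (rule summable_comparison_test)
  show "summable (\<lambda>k. inverse (fact k) * \<bar>z\<bar> ^ k)"
    by (rule summable_exp)
  have "\<bar>z\<bar> ^ k / (fact k * fact k) \<le> inverse (fact k) * \<bar>z\<bar> ^ k" for k
    using frac_le[of "\<bar>z\<bar> ^ k" "\<bar>z\<bar> ^ k" "fact k" "fact k * fact k"]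
    by (simp add: field_simps)
  then show "\<exists>N. \<forall>k\<ge>N. norm (z ^ k / (pochhammer (real a) k * fact k)) \<le> inverse (fact k) * \<bar>z\<bar> ^ k"
    using hyp0F1_term_bound[OF assms] by (intro exI[of _ 0]) (auto intro: order_trans)
qed

lemma hyp0F1_nonneg: "a > 0 \<Longrightarrow> z \<ge> 0 \<Longrightarrow> hyp0F1 a z \<ge> 0"
  unfolding hyp0F1_def
  by (intro suminf_nonneg hyp0F1_term_summable) (auto intro!: divide_nonneg_nonneg mult_nonneg_nonneg pochhammer_nonneg)

text \<open>The two factorials in the series make \<open>hyp0F1\<close> grow more slowly than every
  exponential: one of them absorbs the powers of \<open>1 / c\<close>, since \<open>(1 / c) ^ k / fact k\<close> is a single
  term of the series of \<open>exp (1 / c)\<close>.\<close>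

lemma hyp0F1_exp_bound:
  assumes "a > 0" "c > 0"
  shows "\<bar>hyp0F1 a z\<bar> \<le> exp (1 / c) * exp (c * \<bar>z\<bar>)"
proof -
  have sm: "summable (\<lambda>k. exp (1 / c) * (inverse (fact k) * (c * \<bar>z\<bar>) ^ k))"
    by (intro summable_mult summable_exp)
  have *: "norm (z ^ k / (pochhammer (real a) k * fact k))
      \<le> exp (1 / c) * (inverse (fact k) * (c * \<bar>z\<bar>) ^ k)" for k
  proof -
    have "(\<Sum>i\<in>{k}. inverse (fact i) * (1 / c) ^ i) \<le> (\<Sum>i. inverse (fact i) * (1 / c) ^ i)"
      using assms(2) by (intro sum_le_suminf summable_exp) auto
    then have "inverse (fact k) * (1 / c) ^ k \<le> exp (1 / c)"
      by (simp add: exp_def field_simps)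
    then have "inverse (fact k) * (1 / c) ^ k * (inverse (fact k) * (c * \<bar>z\<bar>) ^ k)
        \<le> exp (1 / c) * (inverse (fact k) * (c * \<bar>z\<bar>) ^ k)"
      using assms(2) by (intro mult_right_mono) auto
    moreover have "inverse (fact k) * (1 / c) ^ k * (inverse (fact k) * (c * \<bar>z\<bar>) ^ k)
        = \<bar>z\<bar> ^ k / (fact k * fact k)"
      using assms(2) by (simp add: power_mult_distrib field_simps)
    ultimately show ?thesis
      using hyp0F1_term_bound[OF assms(1), of z k] by simp
  qed
  have "\<bar>hyp0F1 a z\<bar> \<le> (\<Sum>k. exp (1 / c) * (inverse (fact k) * (c * \<bar>z\<bar>) ^ k))"
    unfolding hyp0F1_def using norm_suminf_le[OF * sm] by simp
  also have "\<dots> = exp (1 / c) * exp (c * \<bar>z\<bar>)"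
    by (simp only: suminf_mult[OF summable_exp] exp_def real_scaleR_def)
  finally show ?thesis .
qed

lemma hyp0F1_has_derivative:
  assumes "a > 0"
  shows "(hyp0F1 a has_real_derivative hyp0F1 (Suc a) z / real a) (at z)"
proof -
  let ?c = "\<lambda>k. inverse (pochhammer (real a) k * fact k)"
  have "((\<lambda>z. \<Sum>k. ?c k * z ^ k) has_real_derivative (\<Sum>k. diffs ?c k * z ^ k)) (at z)"
    using hyp0F1_term_summable[OF assms]
    by (intro termdiffs_strong_converges_everywhere) (simp add: field_simps)
  moreover have "(\<lambda>z. \<Sum>k. ?c k * z ^ k) = hyp0F1 a"
    by (simp add: hyp0F1_def fun_eq_iff field_simps)
  moreover have "diffs ?c k * z ^ k = z ^ k / (pochhammer (real (Suc a)) k * fact k) / real a" for k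
    using assms by (simp add: diffs_def pochhammer_rec field_simps del: of_nat_Suc) (simp add: add.commute)
  ultimately show ?thesis
    using hyp0F1_term_summable[of "Suc a" z]
    by (simp only: hyp0F1_def[of "Suc a"] suminf_divide[symmetric] zero_less_Suc)
qed

lemmas hyp0F1_derivative_intro [derivative_intros] = DERIV_chain2[OF hyp0F1_has_derivative]

lemma continuous_on_hyp0F1 [continuous_intros]:
  assumes "a > 0" "continuous_on S f"
  shows "continuous_on S (\<lambda>t. hyp0F1 a (f t))"
proof -
  have "continuous_on UNIV (hyp0F1 a)"
    using hyp0F1_has_derivative[OF assms(1)]
    by (intro continuous_at_imp_continuous_on ballI) (blast intro: DERIV_isCont)
  from continuous_on_compose2[OF this assms(2)] show ?thesis by simp
qed

text \<open>Coefficientwise this is the difference of the reciprocals of two Pochhammer symbols that share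
  all factors but one; the constant terms cancel, which produces the factor \<open>z\<close>.\<close>

lemma hyp0F1_contiguous:
  assumes "a > 0"
  shows "hyp0F1 a z = hyp0F1 (Suc a) z + z / (real a * (real a + 1)) * hyp0F1 (Suc (Suc a)) z"
proof -
  let ?t = "\<lambda>a k. z ^ k / (pochhammer (real a) k * fact k)"
  let ?q = "\<lambda>k. ?t a k - ?t (Suc a) k"
  have sq: "?q sums (hyp0F1 a z - hyp0F1 (Suc a) z)"
    unfolding hyp0F1_def using assms by (intro sums_diff summable_sums hyp0F1_term_summable) auto
  have "(\<lambda>k. ?q (Suc k)) sums (hyp0F1 a z - hyp0F1 (Suc a) z)"
    using sq sums_Suc_iff[of ?q] by simp
  moreover have "?q (Suc k) = z / (real a * (real a + 1)) * ?t (Suc (Suc a)) k" for k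
  proof -
    define r where "r = pochhammer (real a + 2) k"
    have r: "r > 0" unfolding r_def by (intro pochhammer_pos) auto
    have p2: "pochhammer (real (Suc (Suc a))) k = r"
      by (simp add: r_def add.commute)
    have nz: "real a + 1 + real k > 0" by simp
    have p0: "pochhammer (real a) (Suc k) = real a * (real a + 1) * r / (real a + 1 + real k)"
    proof -
      have "(real a + 1) * r = (real a + 1 + real k) * pochhammer (real a + 1) k"
        using pochhammer_rec[of "real a + 1" k] pochhammer_rec'[of "real a + 1" k]
        by (simp add: r_def add.assoc)
      then have "pochhammer (real a + 1) k = (real a + 1) * r / (real a + 1 + real k)"
        using nz by (simp add: eq_divide_eq mult.commute)
      then show ?thesis by (simp add: pochhammer_rec)
    qed
    have p1: "pochhammer (real (Suc a)) (Suc k) = (real a + 1) * r"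
      by (simp add: r_def pochhammer_rec add.commute)
    show ?thesis
      unfolding p0 p1 p2 using r assms nz
      by (simp add: divide_simps del: of_nat_Suc) (simp add: algebra_simps)
  qed
  ultimately have "(\<lambda>k. z / (real a * (real a + 1)) * ?t (Suc (Suc a)) k) sums
      (hyp0F1 a z - hyp0F1 (Suc a) z)" by simp
  moreover have "(\<lambda>k. z / (real a * (real a + 1)) * ?t (Suc (Suc a)) k) sums
      (z / (real a * (real a + 1)) * hyp0F1 (Suc (Suc a)) z)"
    unfolding hyp0F1_def by (intro sums_mult summable_sums hyp0F1_term_summable) auto
  ultimately show ?thesis
    using sums_unique2 by fastforce
qed

lemma hyp0F1_contiguous_mult:
  assumes "a > 0"
  shows "z * hyp0F1 (Suc (Suc a)) z = real a * (real a + 1) * (hyp0F1 a z - hyp0F1 (Suc a) z)"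
proof -
  have "hyp0F1 a z - hyp0F1 (Suc a) z = z / (real a * (real a + 1)) * hyp0F1 (Suc (Suc a)) z"
    using hyp0F1_contiguous[OF assms, of z] by linarith
  then show ?thesis using assms by simp
qed

section \<open>Incomplete integrals of the hypergeometric function\<close>

lemma H_integrand_continuous:
  assumes "a > 0"
  shows "continuous_on S (\<lambda>t. t ^ k * exp (- t) * hyp0F1 a (t * y))"
  using assms by (intro continuous_intros) auto

lemma H_contiguous:
  assumes "a > 0"
  shows "H k a x y = H k (Suc a) x y + y / (real a * (real a + 1)) * H (Suc k) (Suc (Suc a)) x y"
proof -
  let ?g = "\<lambda>k a t. t ^ k * exp (- t) * hyp0F1 a (t * y)"
  have int: "?g k b integrable_on {0..x}" if "b > 0" for k b
    using H_integrand_continuous[OF that] by (rule integrable_continuous_real)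
  have "H k a x y = integral {0..x} (\<lambda>t. ?g k (Suc a) t + y / (real a * (real a + 1)) * ?g (Suc k) (Suc (Suc a)) t)"
    unfolding H_def by (intro integral_cong, subst hyp0F1_contiguous[OF assms]) (simp add: algebra_simps)
  also have "\<dots> = H k (Suc a) x y + integral {0..x} (\<lambda>t. y / (real a * (real a + 1)) * ?g (Suc k) (Suc (Suc a)) t)"
    unfolding H_def
    by (rule integral_add[OF int[OF zero_less_Suc] integrable_on_mult_right[OF int[OF zero_less_Suc]]])
  finally show ?thesis by (simp only: H_def integral_mult_right)
qed

text \<open>This is integration by parts against \<open>exp (- t)\<close>: the derivative of
  \<open>t ^ a * hyp0F1 (a + 1) (t * y)\<close> is \<open>a * t ^ (a - 1) * hyp0F1 a (t * y)\<close>, by the contiguous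
  relation.\<close>

lemma H_by_parts:
  assumes "x \<ge> 0"
  shows "real (Suc m) * H m (Suc m) x y
     = x ^ Suc m * exp (- x) * hyp0F1 (Suc (Suc m)) (x * y) + H (Suc m) (Suc (Suc m)) x y"
proof -
  let ?g = "\<lambda>k a t. t ^ k * exp (- t) * hyp0F1 a (t * y)"
  have int: "?g k b integrable_on {0..x}" if "b > 0" for k b
    using H_integrand_continuous[OF that] by (rule integrable_continuous_real)
  have deriv: "(?g (Suc m) (Suc (Suc m)) has_real_derivative
      real (Suc m) * ?g m (Suc m) t - ?g (Suc m) (Suc (Suc m)) t) (at t within {0..x})" for t
  proof -
    define u v where "u = hyp0F1 (Suc (Suc m)) (t * y)" and "v = hyp0F1 (Suc (Suc (Suc m))) (t * y)"
    have D: "(?g (Suc m) (Suc (Suc m)) has_real_derivative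
        real (Suc m) * t ^ m * exp (- t) * u - t ^ Suc m * exp (- t) * u
        + t ^ Suc m * exp (- t) * (v / real (Suc (Suc m)) * y)) (at t within {0..x})"
      unfolding u_def v_def by (auto intro!: derivative_eq_intros simp: algebra_simps simp del: power_Suc)
    have eq: "hyp0F1 (Suc m) (t * y) = u + t * y / (real (Suc m) * real (Suc (Suc m))) * v"
      using hyp0F1_contiguous[of "Suc m" "t * y"] by (simp add: u_def v_def add.commute)
    have "A * tm * c * u - t * tm * c * u + t * tm * c * (v / B * y)
        = A * (tm * c * (u + t * y / (A * B) * v)) - t * tm * c * u" if "A \<noteq> 0" "B \<noteq> 0" for A B c tm :: real
      using that by (simp add: field_simps)
    from this[of "real (Suc m)" "real (Suc (Suc m))" "t ^ m" "exp (- t)"]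
    have "real (Suc m) * t ^ m * exp (- t) * u - t ^ Suc m * exp (- t) * u
        + t ^ Suc m * exp (- t) * (v / real (Suc (Suc m)) * y)
        = real (Suc m) * ?g m (Suc m) t - ?g (Suc m) (Suc (Suc m)) t"
      unfolding eq u_def[symmetric] power_Suc by (simp only: of_nat_eq_0_iff Suc_neq_Zero simp_thms not_False_eq_True)
    with D show ?thesis by (simp only:)
  qed
  have "((\<lambda>t. real (Suc m) * ?g m (Suc m) t - ?g (Suc m) (Suc (Suc m)) t) has_integral
      ?g (Suc m) (Suc (Suc m)) x - ?g (Suc m) (Suc (Suc m)) 0) {0..x}"
    using assms deriv
    by (intro fundamental_theorem_of_calculus) (auto simp: has_real_derivative_iff_has_vector_derivative[symmetric])
  moreover have "((\<lambda>t. real (Suc m) * ?g m (Suc m) t - ?g (Suc m) (Suc (Suc m)) t) has_integral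
      real (Suc m) * H m (Suc m) x y - H (Suc m) (Suc (Suc m)) x y) {0..x}"
    unfolding H_def by (intro has_integral_diff has_integral_mult_right integrable_integral int) auto
  ultimately have "real (Suc m) * H m (Suc m) x y - H (Suc m) (Suc (Suc m)) x y
      = ?g (Suc m) (Suc (Suc m)) x - ?g (Suc m) (Suc (Suc m)) 0"
    by (rule has_integral_unique[symmetric])
  then show ?thesis by simp
qed

lemma H_deriv_parameter:
  assumes "a > 0"
  shows "((\<lambda>y. H k a x y) has_real_derivative H (Suc k) (Suc a) x y / real a) (at y)"
proof -
  have "((\<lambda>y. integral (cbox 0 x) (\<lambda>t. t ^ k * exp (- t) * hyp0F1 a (t * y))) has_real_derivative
      integral (cbox 0 x) (\<lambda>t. t ^ Suc k * exp (- t) * hyp0F1 (Suc a) (t * y) / real a)) (at y within UNIV)"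
  proof (rule leibniz_rule_field_derivative)
    show "((\<lambda>y. t ^ k * exp (- t) * hyp0F1 a (t * y)) has_real_derivative
        t ^ Suc k * exp (- t) * hyp0F1 (Suc a) (t * y) / real a) (at y within UNIV)" for y t
      using assms by (auto intro!: derivative_eq_intros)
    show "(\<lambda>t. t ^ k * exp (- t) * hyp0F1 a (t * y)) integrable_on cbox 0 x" for y
      using H_integrand_continuous[OF assms] by (auto intro: integrable_continuous_real)
    show "continuous_on (UNIV \<times> cbox 0 x)
        (\<lambda>(y, t). t ^ Suc k * exp (- t) * hyp0F1 (Suc a) (t * y) / real a)"
      unfolding split_beta using assms by (intro continuous_intros) auto
  qed auto
  then show ?thesis by (simp add: H_def)
qed

lemma H_deriv_limit:
  assumes "a > 0" "x > 0"
  shows "((\<lambda>x. H k a x y) has_real_derivative x ^ k * exp (- x) * hyp0F1 a (x * y)) (at x)"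
proof -
  have "((\<lambda>x. H k a x y) has_real_derivative x ^ k * exp (- x) * hyp0F1 a (x * y)) (at x within {0..x+1})"
    unfolding H_def using assms by (intro integral_has_real_derivative H_integrand_continuous) auto
  moreover have "at x within {0..x+1} = at x"
    using assms by (intro at_within_interior) auto
  ultimately show ?thesis by simp
qed

lemma H_exp_decay:
  assumes "a > 0" "x > 0"
  shows "((\<lambda>y. exp (- y) * H k a x y) \<longlongrightarrow> 0) at_top"
proof (rule Lim_null_comparison)
  define C where "C = x ^ k * exp (2 * x) * x"
  show "((\<lambda>y. C * exp (- (y / 2))) \<longlongrightarrow> 0) at_top"
  proof -
    have "filterlim (\<lambda>y::real. (- 1 / 2) * y) at_bot at_top"
      by (rule filterlim_tendsto_neg_mult_at_bot[OF tendsto_const _ filterlim_ident]) simp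
    from filterlim_compose[OF exp_at_bot this] show ?thesis
      using tendsto_mult_right_zero[of "\<lambda>y. exp ((- 1 / 2) * y)" at_top C] by simp
  qed
  have "norm (exp (- y) * H k a x y) \<le> C * exp (- (y / 2))" if y: "y \<ge> 0" for y
  proof -
    have "norm (integral (cbox 0 x) (\<lambda>t. t ^ k * exp (- t) * hyp0F1 a (t * y)))
        \<le> (x ^ k * 1 * (exp (2 * x) * exp (y / 2))) * measure lborel (cbox 0 x)"
    proof (rule integrable_bound)
      fix t assume t: "t \<in> cbox 0 x"
      \<comment> \<open>The rate \<open>1 / (2 * x)\<close> makes the growth in \<open>y\<close> at most \<open>exp (y / 2)\<close>, as \<open>t \<le> x\<close>.\<close>
      have "\<bar>hyp0F1 a (t * y)\<bar> \<le> exp (1 / (1 / (2 * x))) * exp (1 / (2 * x) * \<bar>t * y\<bar>)"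
        using assms by (intro hyp0F1_exp_bound) auto
      also have "\<dots> \<le> exp (2 * x) * exp (y / 2)"
        using t y assms(2) mult_right_mono[of t x y] by (simp add: field_simps abs_mult)
      finally show "norm (t ^ k * exp (- t) * hyp0F1 a (t * y)) \<le> x ^ k * 1 * (exp (2 * x) * exp (y / 2))"
        unfolding real_norm_def abs_mult using t assms(2)
        by (intro mult_mono) (auto intro: power_mono simp: power_abs)
    qed (use assms H_integrand_continuous[OF assms(1)] in \<open>auto intro: integrable_continuous_real\<close>)
    then have "\<bar>H k a x y\<bar> \<le> C * exp (y / 2)"
      using assms(2) by (simp add: H_def C_def mult_ac)
    then have "exp (- y) * \<bar>H k a x y\<bar> \<le> exp (- y) * (C * exp (y / 2))"
      by (intro mult_left_mono) auto
    also have "\<dots> = C * exp (- (y / 2))"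
      by (simp add: mult.left_commute flip: exp_add)
    finally show ?thesis by (simp add: abs_mult)
  qed
  then show "\<forall>\<^sub>F y in at_top. norm (exp (- y) * H k a x y) \<le> C * exp (- (y / 2))"
    using eventually_ge_at_top[of 0] by (rule eventually_mono[rotated])
qed

section \<open>Tail integrals\<close>

definition exp_tail :: "nat \<Rightarrow> real \<Rightarrow> real \<Rightarrow> real" where
  "exp_tail b x y = exp y * integral {y..} (\<lambda>t. exp (- t) * hyp0F1 b (x * t))"

text \<open>By \<open>H_deriv_parameter\<close> and \<open>H_by_parts\<close>, the function \<open>exp (- y) * H m (m + 1) x y\<close> is, up
  to a constant, an antiderivative in \<open>y\<close> of the integrand of the tail integral, and it vanishes at
  infinity by \<open>H_exp_decay\<close>. This also gives the existence of the improper integral. The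
  identity is needed for negative \<open>y\<close> as well, because it is differentiated at \<open>y = 0\<close>.\<close>

lemma H_eq_exp_tail:
  assumes "x > 0"
  shows "H m (Suc m) x y = x ^ Suc m * exp (- x) / real (Suc m) * exp_tail (Suc (Suc m)) x y"
proof -
  define c where "c = real (Suc m) * exp x / x ^ Suc m"
  define f where "f = (\<lambda>t. exp (- t) * hyp0F1 (Suc (Suc m)) (x * t))"
  define \<Phi> where "\<Phi> = (\<lambda>y. - (c * (exp (- y) * H m (Suc m) x y)))"
  have cp: "c * (x ^ Suc m * exp (- x)) = real (Suc m)"
    using assms by (simp add: c_def exp_minus field_simps)
  have d\<Phi>: "(\<Phi> has_real_derivative f t) (at t)" for t
  proof -
    have eq: "real (Suc m) * H m (Suc m) x t - H (Suc m) (Suc (Suc m)) x t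
        = x ^ Suc m * exp (- x) * hyp0F1 (Suc (Suc m)) (x * t)"
      using H_by_parts[of x m t] assms by simp
    have "(\<Phi> has_real_derivative
        c * exp (- t) * (real (Suc m) * H m (Suc m) x t - H (Suc m) (Suc (Suc m)) x t) / real (Suc m)) (at t)"
      unfolding \<Phi>_def by (auto intro!: derivative_eq_intros H_deriv_parameter simp: field_simps)
    moreover have "c * exp (- t) * (x ^ Suc m * exp (- x) * hyp0F1 (Suc (Suc m)) (x * t)) / real (Suc m)
        = (c * (x ^ Suc m * exp (- x))) * f t / real (Suc m)"
      by (simp add: f_def)
    ultimately show ?thesis unfolding eq cp by simp
  qed
  have fint: "(f has_integral \<Phi> b - \<Phi> a) {a..b}" if "a \<le> b" for a b
    using d\<Phi> that by (intro fundamental_theorem_of_calculus)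
      (auto simp: has_real_derivative_iff_has_vector_derivative[symmetric] intro: has_field_derivative_at_within)
  have \<Phi>_lim: "(\<Phi> \<longlongrightarrow> 0) at_top"
    unfolding \<Phi>_def using tendsto_mult_right_zero[OF H_exp_decay[of "Suc m" x m], of c] assms
    by (auto intro: tendsto_minus_cancel)
  \<comment> \<open>For \<open>a \<ge> 0\<close> the integrand is nonnegative, so the limit of the proper integrals suffices.\<close>
  have nonneg_case: "(f has_integral - \<Phi> a) {a..}" if "a \<ge> 0" for a
  proof (rule has_integral_to_inf)
    show "f integrable_on {a..b}" for b
      using fint[of a b] by (cases "a \<le> b") (auto simp: integrable_on_def)
    have "((\<lambda>b. \<Phi> b - \<Phi> a) \<longlongrightarrow> 0 - \<Phi> a) at_top"
      by (intro tendsto_intros \<Phi>_lim)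
    moreover have "\<forall>\<^sub>F b in at_top. \<Phi> b - \<Phi> a = integral {a..b} f"
      by (auto intro: eventually_mono[OF eventually_ge_at_top[of a]] simp: integral_unique[OF fint])
    ultimately show "((\<lambda>b. integral {a..b} f) \<longlongrightarrow> - \<Phi> a) at_top"
      by (auto intro: Lim_transform_eventually)
    show "f t \<ge> 0" if "t \<ge> a" for t
      using that \<open>a \<ge> 0\<close> assms by (auto simp: f_def intro!: mult_nonneg_nonneg hyp0F1_nonneg)
  qed
  have "(f has_integral - \<Phi> y) {y..}"
  proof (cases "y \<ge> 0")
    case False
    have "(f has_integral (\<Phi> 0 - \<Phi> y) + (- \<Phi> 0)) ({y..0} \<union> {0..})"
    proof (rule has_integral_Un)
      show "negligible ({y..0} \<inter> {0..})"
        by (rule negligible_subset[of "{0}"]) auto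
    qed (use False fint nonneg_case in auto)
    moreover have "{y..0} \<union> {0..} = {y..}" using False by auto
    ultimately show ?thesis by simp
  qed (rule nonneg_case)
  then have "exp_tail (Suc (Suc m)) x y = exp y * (c * (exp (- y) * H m (Suc m) x y))"
    by (simp add: exp_tail_def f_def \<Phi>_def integral_unique)
  also have "\<dots> = c * H m (Suc m) x y"
    by (simp add: exp_minus)
  finally have "x ^ Suc m * exp (- x) * exp_tail (Suc (Suc m)) x y = c * (x ^ Suc m * exp (- x)) * H m (Suc m) x y"
    by (simp only: mult_ac)
  then show ?thesis
    unfolding cp by (simp add: field_simps del: of_nat_Suc power_Suc)
qed

lemma exp_tail_rec:
  assumes "x > 0"
  shows "exp_tail (Suc (Suc m)) x y
    = hyp0F1 (Suc (Suc m)) (x * y) + x / real (Suc (Suc m)) * exp_tail (Suc (Suc (Suc m))) x y"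
proof -
  define p where "p = x ^ Suc m * exp (- x)"
  have p: "p > 0" using assms by (simp add: p_def)
  have "p * exp_tail (Suc (Suc m)) x y
    = p * hyp0F1 (Suc (Suc m)) (x * y) + p * (x / real (Suc (Suc m)) * exp_tail (Suc (Suc (Suc m))) x y)"
    using H_by_parts[of x m y] assms unfolding H_eq_exp_tail[OF assms] p_def
    by (simp del: of_nat_Suc)
  then have "p * exp_tail (Suc (Suc m)) x y
    = p * (hyp0F1 (Suc (Suc m)) (x * y) + x / real (Suc (Suc m)) * exp_tail (Suc (Suc (Suc m))) x y)"
    by (simp only: distrib_left)
  then show ?thesis using p by simp
qed

lemma exp_tail_has_derivative:
  assumes "x > 0"
  shows "((\<lambda>y. exp_tail (Suc (Suc m)) x y) has_real_derivative
    exp_tail (Suc (Suc m)) x y - hyp0F1 (Suc (Suc m)) (x * y)) (at y)"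
proof -
  define c where "c = real (Suc m) / (x ^ Suc m * exp (- x))"
  have "(\<lambda>y. exp_tail (Suc (Suc m)) x y) = (\<lambda>y. c * H m (Suc m) x y)"
    using assms by (simp add: H_eq_exp_tail c_def fun_eq_iff)
  moreover have "((\<lambda>y. c * H m (Suc m) x y) has_real_derivative
      c * (H (Suc m) (Suc (Suc m)) x y / real (Suc m))) (at y)"
    by (intro DERIV_cmult H_deriv_parameter) auto
  moreover have "c * (H (Suc m) (Suc (Suc m)) x y / real (Suc m))
      = exp_tail (Suc (Suc m)) x y - hyp0F1 (Suc (Suc m)) (x * y)"
    using assms by (subst exp_tail_rec) (simp_all add: H_eq_exp_tail c_def del: of_nat_Suc)
  ultimately show ?thesis by simp
qed

lemma G2_exp_tail:
  "G2 n x y = real n * hyp0F1 n (x * y) + y * hyp0F1 (Suc n) (x * y)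
     + (x - y - real n + 1) * exp_tail (Suc n) x y"
  by (simp add: G2_def exp_tail_def)

text \<open>Everything except \<open>- exp_tail\<close> reassembles to \<open>G2\<close>: the third hypergeometric function that
  appears on differentiation carries the factor \<open>x * y\<close> and is removed by the contiguous relation.\<close>

lemma G2_has_derivative:
  assumes "x > 0" "n > 0"
  shows "((\<lambda>y. G2 n x y) has_real_derivative G2 n x y - exp_tail (Suc n) x y) (at y)"
proof -
  obtain m where n: "n = Suc m" using assms(2) gr0_conv_Suc by blast
  let ?u = "hyp0F1 n (x * y)" and ?v = "hyp0F1 (Suc n) (x * y)" and ?w = "hyp0F1 (Suc (Suc n)) (x * y)"
    and ?e = "exp_tail (Suc n) x y"
  have w: "x * y * ?w / real (Suc n) = real n * (?u - ?v)"
    using hyp0F1_contiguous_mult[OF assms(2), of "x * y"] assms(2) by (simp add: add.commute)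
  have du: "((\<lambda>y. hyp0F1 n (x * y)) has_real_derivative ?v / real n * x) (at y)"
    and dv: "((\<lambda>y. hyp0F1 (Suc n) (x * y)) has_real_derivative ?w / real (Suc n) * x) (at y)"
    using assms by (auto intro!: derivative_eq_intros)
  have de: "((\<lambda>y. exp_tail (Suc n) x y) has_real_derivative ?e - ?v) (at y)"
    using exp_tail_has_derivative[OF assms(1), of m y] n by simp
  have "((\<lambda>y. G2 n x y) has_real_derivative
      real n * (?v / real n * x) + (1 * ?v + ?w / real (Suc n) * x * y)
        + ((1 - 0 - 0 - 1 + 0 - 0) * ?e + - 1 * ?e + (?e - ?v) * (x - y - real n + 1))) (at y)"
    unfolding G2_exp_tail by (rule derivative_eq_intros du dv de refl | simp)+
  then have "((\<lambda>y. G2 n x y) has_real_derivative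
      x * ?v + (?v + x * y * ?w / real (Suc n)) - ?e + (x - y - real n + 1) * (?e - ?v)) (at y)"
    by (rule DERIV_cong) (use assms(2) in \<open>simp add: mult_ac\<close>)
  then show ?thesis
    unfolding w by (simp add: G2_exp_tail algebra_simps)
qed

lemma G3_exp_tail:
  assumes "x > 0" "n > 0"
  shows "G3 n x y = (x - y - real n + 3) * G2 n x y + (2 * y + real n - 1) * exp_tail (Suc n) x y
    - y * hyp0F1 (Suc n) (x * y)"
proof -
  obtain m where n: "n = Suc m" using assms(2) gr0_conv_Suc by blast
  have d1: "deriv (\<lambda>y. G2 n x y) = (\<lambda>y. G2 n x y - exp_tail (Suc n) x y)"
    using G2_has_derivative[OF assms] by (auto intro: DERIV_imp_deriv)
  have "((\<lambda>y. G2 n x y - exp_tail (Suc n) x y) has_real_derivative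
      G2 n x y - 2 * exp_tail (Suc n) x y + hyp0F1 (Suc n) (x * y)) (at y)"
    using DERIV_diff[OF G2_has_derivative[OF assms, of y] exp_tail_has_derivative[OF assms(1), of m y]]
    by (simp add: n algebra_simps)
  then have d2: "deriv (deriv (\<lambda>y. G2 n x y)) y = G2 n x y - 2 * exp_tail (Suc n) x y + hyp0F1 (Suc n) (x * y)"
    unfolding d1 by (rule DERIV_imp_deriv)
  then show ?thesis
    unfolding G3_def d2 unfolding d1 by (simp add: algebra_simps)
qed

section \<open>The combinations of columns that give G2 and G3\<close>

text \<open>Both sides are combinations of \<open>e\<close>, \<open>v\<close> and \<open>w\<close> below. Taking \<open>k\<close> as the unit, with all
  denominators inside it, makes every coefficient a polynomial.\<close>

lemma H_combination_G2:
  assumes "x > 0"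
  shows "H (Suc m) (Suc m) x y - x * H m (Suc m) x y
    = - (x ^ Suc (Suc m) * exp (- x) / (real (Suc m) * real (Suc (Suc m)))) * G2 (Suc (Suc m)) x y"
proof -
  define A k where "A = real (Suc m)" and "k = x ^ Suc m * exp (- x) / (real (Suc m) * real (Suc (Suc m)))"
  have A: "A > 0" by (simp add: A_def)
  have r: "real (Suc m) = A" "real (Suc (Suc m)) = A + 1" by (simp_all add: A_def)
  define v w where "v = hyp0F1 (Suc (Suc m)) (x * y)" and "w = hyp0F1 (Suc (Suc (Suc m))) (x * y)"
  define e where "e = exp_tail (Suc (Suc (Suc m))) x y"
  have p: "x ^ Suc m * exp (- x) = A * (A + 1) * k"
    using A unfolding k_def r by simp
  have xp: "x ^ Suc (Suc m) * exp (- x) = x * (A * (A + 1) * k)"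
    unfolding p[symmetric] by simp
  have J1: "H (Suc m) (Suc (Suc m)) x y = x * A * k * e"
    using A unfolding H_eq_exp_tail[OF assms] e_def[symmetric] xp r by simp
  have "A * H m (Suc m) x y = A * ((A + 1) * k * v + x * k * e)"
    using H_by_parts[of x m y] assms unfolding J1 p v_def[symmetric] r
    by (simp add: algebra_simps)
  then have J0: "H m (Suc m) x y = (A + 1) * k * v + x * k * e"
    using A by simp
  have J2: "H (Suc (Suc m)) (Suc (Suc (Suc m))) x y = A * (A + 1) * (x * k * (e - w))"
    using H_by_parts[of x "Suc m" y] assms unfolding J1 xp w_def[symmetric] r
    by (simp add: algebra_simps)
  have c: "H (Suc m) (Suc m) x y = x * A * k * e + y * (x * k * (e - w))"
    using H_contiguous[of "Suc m" "Suc m" x y] A unfolding J1 J2 r by simp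
  have "x ^ Suc (Suc m) * exp (- x) / (real (Suc m) * real (Suc (Suc m))) = x * k"
    using A unfolding xp r by simp
  then show ?thesis
    unfolding c J0 G2_exp_tail e_def[symmetric] v_def[symmetric] w_def[symmetric]
    by (simp only: r) (simp add: algebra_simps)
qed

text \<open>As in the previous identity, everything is expressed through \<open>u\<close>, \<open>v\<close> and \<open>e\<close>, with coefficients that are polynomials in \<open>x\<close>,
  \<open>y\<close>, \<open>A\<close> and \<open>k\<close>. The multiple of \<open>G2 (n - 1)\<close> is forced by comparing coefficients of \<open>e\<close>;
  that the coefficients of \<open>u\<close> and \<open>v\<close> then agree too, without a contribution of
  \<open>hyp0F1 (n - 2)\<close>, is the content of the identity.\<close>

lemma H_combination_G3:
  assumes "x > 0"
  shows "H (Suc (Suc m)) (Suc m) x y - x * H (Suc m) (Suc m) x y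
    = x ^ Suc (Suc (Suc m)) * exp (- x) / (real (Suc m) * real (Suc (Suc m)) * real (Suc (Suc (Suc m))))
      * (G3 (Suc (Suc (Suc m))) x y - real (Suc (Suc (Suc m))) * G2 (Suc (Suc m)) x y)"
proof -
  define A where "A = real (Suc m)"
  define k where "k = x ^ Suc (Suc (Suc m)) * exp (- x)
    / (real (Suc m) * real (Suc (Suc m)) * real (Suc (Suc (Suc m))))"
  have A: "A > 0" by (simp add: A_def)
  have r: "real (Suc m) = A" "real (Suc (Suc m)) = A + 1" "real (Suc (Suc (Suc m))) = A + 2"
    "real (Suc (Suc (Suc (Suc m)))) = A + 3" by (simp_all add: A_def)
  define t u v w where "t = hyp0F1 (Suc (Suc m)) (x * y)" and "u = hyp0F1 (Suc (Suc (Suc m))) (x * y)"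
    and "v = hyp0F1 (Suc (Suc (Suc (Suc m)))) (x * y)"
    and "w = hyp0F1 (Suc (Suc (Suc (Suc (Suc m))))) (x * y)"
  define e where "e = exp_tail (Suc (Suc (Suc (Suc m)))) x y"
  have P: "x ^ Suc (Suc (Suc m)) * exp (- x) = A * (A + 1) * (A + 2) * k"
    using A unfolding k_def r by simp
  have xP: "x ^ Suc (Suc (Suc (Suc m))) * exp (- x) = x * (A * (A + 1) * (A + 2) * k)"
    unfolding P[symmetric] by simp
  have t0: "t = u + x * y / ((A + 1) * (A + 2)) * v"
    using hyp0F1_contiguous[of "Suc (Suc m)" "x * y"]
    unfolding t_def[symmetric] u_def[symmetric] v_def[symmetric] r
    by (simp only: add.assoc one_add_one zero_less_Suc simp_thms)
  then have t: "(A + 1) * t = (A + 1) * u + x * y * v / (A + 2)"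
    using A unfolding t0
    by (simp add: distrib_left[of "A + 1" u] del: distrib_left_numeral distrib_right_numeral)
  have w: "x * y * w = (A + 2) * (A + 3) * (u - v)"
    using hyp0F1_contiguous_mult[of "Suc (Suc (Suc m))" "x * y"] unfolding w_def u_def v_def r
    by (simp add: add.assoc)
  have J2: "H (Suc (Suc m)) (Suc (Suc (Suc m))) x y = A * (A + 1) * k * e"
    using A unfolding H_eq_exp_tail[OF assms] e_def[symmetric] P r by simp
  have "(A + 1) * (x * H (Suc m) (Suc (Suc m)) x y)
      = x ^ Suc (Suc (Suc m)) * exp (- x) * u + x * (A * (A + 1) * k * e)"
    using H_by_parts[of x "Suc m" y] assms unfolding J2 u_def[symmetric] r
    by (simp add: algebra_simps)
  then have "(A + 1) * (x * H (Suc m) (Suc (Suc m)) x y) = (A + 1) * (A * (A + 2) * k * u + x * A * k * e)"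
    unfolding P by (simp add: algebra_simps)
  then have J1: "x * H (Suc m) (Suc (Suc m)) x y = A * (A + 2) * k * u + x * A * k * e"
    using A by simp
  have J3: "H (Suc (Suc (Suc m))) (Suc (Suc (Suc (Suc m)))) x y = A * (A + 1) * (A + 2) * (k * (e - v))"
    using H_by_parts[of x "Suc (Suc m)" y] assms unfolding J2 v_def[symmetric] P r
    by (simp add: algebra_simps)
  \<comment> \<open>Only after multiplication by \<open>y\<close> can the contiguous relation eliminate \<open>w\<close>.\<close>
  have J4': "H (Suc (Suc (Suc (Suc m)))) (Suc (Suc (Suc (Suc (Suc m))))) x y
      = A * (A + 1) * (A + 2) * (k * ((A + 3) * (e - v) - x * w))"
    using H_by_parts[of x "Suc (Suc (Suc m))" y] assms unfolding J3 w_def[symmetric] xP r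
    by (simp add: algebra_simps)
  have "y * H (Suc (Suc (Suc (Suc m)))) (Suc (Suc (Suc (Suc (Suc m))))) x y
      = A * (A + 1) * (A + 2) * (k * ((A + 3) * y * (e - v) - x * y * w))"
    unfolding J4' by (simp add: algebra_simps)
  then have J4: "y * H (Suc (Suc (Suc (Suc m)))) (Suc (Suc (Suc (Suc (Suc m))))) x y
      = A * (A + 1) * ((A + 2) * (A + 3) * (k * (y * (e - v) - (A + 2) * (u - v))))"
    unfolding w by (simp add: algebra_simps)
  have e': "exp_tail (Suc (Suc (Suc m))) x y = u + x * e / (A + 2)"
    using exp_tail_rec[OF assms, of "Suc m" y] unfolding u_def e_def r by simp
  have "H (Suc m) (Suc m) x y = H (Suc m) (Suc (Suc m)) x y + y * k * e"
    using H_contiguous[of "Suc m" "Suc m" x y] A unfolding J2 r by simp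
  then have c1: "x * H (Suc m) (Suc m) x y = A * (A + 2) * k * u + x * A * k * e + x * (y * k * e)"
    by (simp add: J1 distrib_left)
  have c3: "H (Suc (Suc m)) (Suc (Suc m)) x y = A * (A + 1) * k * e + y * A * (k * (e - v))"
    using H_contiguous[of "Suc (Suc m)" "Suc (Suc m)" x y] A unfolding J2 J3 r
    by (simp add: add.assoc)
  have "1 / ((A + 2) * (A + 3)) * (y * H (Suc (Suc (Suc (Suc m)))) (Suc (Suc (Suc (Suc (Suc m))))) x y)
      = A * (A + 1) * (k * (y * (e - v) - (A + 2) * (u - v)))"
    using A unfolding J4 by simp
  then have c4: "H (Suc (Suc (Suc m))) (Suc (Suc (Suc m))) x y
      = A * (A + 1) * ((A + 2) * (k * (e - v)) + k * (y * (e - v) - (A + 2) * (u - v)))"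
    using H_contiguous[of "Suc (Suc (Suc m))" "Suc (Suc (Suc m))" x y] unfolding J3 r
    by (simp add: add.assoc distrib_left)
  have c2: "H (Suc (Suc m)) (Suc m) x y = A * (A + 1) * k * e + y * A * (k * (e - v))
      + y * ((A + 2) * (k * (e - v)) + k * (y * (e - v) - (A + 2) * (u - v)))"
    using H_contiguous[of "Suc m" "Suc (Suc m)" x y] A unfolding c3 c4 r by simp
  have "(A + 2) * G2 (Suc (Suc m)) x y
      = (A + 2) * ((A + 1) * u + y * u + (x - y - A) * u)
        + (A + 2) * (x * y * v / (A + 2)) + (x - y - A) * ((A + 2) * (x * e / (A + 2)))"
    unfolding G2_exp_tail r e' t_def[symmetric] u_def[symmetric] t by (simp add: algebra_simps)
  then have G2a: "(A + 2) * G2 (Suc (Suc m)) x y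
      = (A + 2) * ((A + 1) * u + y * u + (x - y - A) * u) + x * y * v + (x - y - A) * (x * e)"
    using A by simp
  have G2b: "G2 (Suc (Suc (Suc m))) x y = (A + 2) * u + y * v + (x - y - A - 1) * e"
    unfolding G2_exp_tail r e_def u_def v_def by (simp add: algebra_simps)
  have G3: "G3 (Suc (Suc (Suc m))) x y
      = (x - y - A + 1) * ((A + 2) * u + y * v + (x - y - A - 1) * e) + (2 * y + A + 1) * e - y * v"
    using G3_exp_tail[OF assms, of "Suc (Suc (Suc m))" y] unfolding G2b e_def[symmetric] v_def[symmetric] r
    by (simp add: algebra_simps)
  show ?thesis
    unfolding k_def[symmetric] c1 c2 unfolding r G3 G2a
    by algebra
qed

section \<open>The determinant\<close>

lemma det_3_has_derivative:
  fixes a b c :: "'i \<Rightarrow> real \<Rightarrow> real"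
  assumes "\<And>i. (a i has_real_derivative a' i) (at x)"
    and "\<And>i. (b i has_real_derivative b' i) (at x)"
    and "\<And>i. (c i has_real_derivative c' i) (at x)"
  shows "((\<lambda>x. det (vector [vector [a i x, b i x, c i x], vector [a j x, b j x, c j x],
        vector [a k x, b k x, c k x]] :: real ^ 3 ^ 3)) has_real_derivative
      det (vector [vector [a' i, b i x, c i x], vector [a' j, b j x, c j x], vector [a' k, b k x, c k x]] :: real ^ 3 ^ 3)
    + det (vector [vector [a i x, b' i, c i x], vector [a j x, b' j, c j x], vector [a k x, b' k, c k x]] :: real ^ 3 ^ 3)
    + det (vector [vector [a i x, b i x, c' i], vector [a j x, b j x, c' j], vector [a k x, b k x, c' k]] :: real ^ 3 ^ 3)) (at x)"
  unfolding det_3 vector_3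
  by (rule DERIV_cong, (rule DERIV_add DERIV_diff DERIV_mult assms)+) (simp add: algebra_simps)

lemma det_3_scale_columns:
  fixes q :: real
  shows "det (vector [vector [q * a1, b1, c1], vector [q * a2, b2, c2], vector [q * a3, b3, c3]] :: real ^ 3 ^ 3)
      = q * det (vector [vector [a1, b1, c1], vector [a2, b2, c2], vector [a3, b3, c3]] :: real ^ 3 ^ 3)"
    and "det (vector [vector [a1, q * b1, c1], vector [a2, q * b2, c2], vector [a3, q * b3, c3]] :: real ^ 3 ^ 3)
      = q * det (vector [vector [a1, b1, c1], vector [a2, b2, c2], vector [a3, b3, c3]] :: real ^ 3 ^ 3)"
    and "det (vector [vector [a1, b1, q * c1], vector [a2, b2, q * c2], vector [a3, b3, q * c3]] :: real ^ 3 ^ 3)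
      = q * det (vector [vector [a1, b1, c1], vector [a2, b2, c2], vector [a3, b3, c3]] :: real ^ 3 ^ 3)"
  by (simp_all add: det_3 algebra_simps)

lemma R3_eq_sum_det:
  assumes "x > 0"
  shows "R3 (Suc (Suc (Suc m))) x l1 l2 l3 =
    (let f = \<lambda>l. hyp0F1 (Suc m) (x * l);
         a = \<lambda>l. H (Suc (Suc m)) (Suc m) x l; b = \<lambda>l. H (Suc m) (Suc m) x l; c = \<lambda>l. H m (Suc m) x l
     in x ^ m * exp (- x) *
       (det (vector [vector [x\<^sup>2 * f l1, b l1, c l1], vector [x\<^sup>2 * f l2, b l2, c l2], vector [x\<^sup>2 * f l3, b l3, c l3]] :: real ^ 3 ^ 3)
      + det (vector [vector [a l1, x * f l1, c l1], vector [a l2, x * f l2, c l2], vector [a l3, x * f l3, c l3]] :: real ^ 3 ^ 3)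
      + det (vector [vector [a l1, b l1, f l1], vector [a l2, b l2, f l2], vector [a l3, b l3, f l3]] :: real ^ 3 ^ 3)))"
proof -
  define q where "q = x ^ m * exp (- x)"
  have da: "((\<lambda>x. H (Suc (Suc m)) (Suc m) x l) has_real_derivative q * (x\<^sup>2 * hyp0F1 (Suc m) (x * l))) (at x)"
    and db: "((\<lambda>x. H (Suc m) (Suc m) x l) has_real_derivative q * (x * hyp0F1 (Suc m) (x * l))) (at x)"
    and dc: "((\<lambda>x. H m (Suc m) x l) has_real_derivative q * hyp0F1 (Suc m) (x * l)) (at x)" for l
    using H_deriv_limit[of "Suc m" x, OF _ assms, of "Suc (Suc m)" l]
      H_deriv_limit[of "Suc m" x, OF _ assms, of "Suc m" l] H_deriv_limit[of "Suc m" x, OF _ assms, of m l]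
    by (simp_all add: q_def power2_eq_square mult_ac)
  have s: "Suc (Suc (Suc m)) - 1 = Suc (Suc m)" "Suc (Suc (Suc m)) - 2 = Suc m" "Suc (Suc (Suc m)) - 3 = m"
    by simp_all
  show ?thesis
    unfolding R3_def Let_def s q_def[symmetric]
    by (subst DERIV_imp_deriv[OF det_3_has_derivative
        [where a = "\<lambda>l x. H (Suc (Suc m)) (Suc m) x l" and b = "\<lambda>l x. H (Suc m) (Suc m) x l"
          and c = "\<lambda>l x. H m (Suc m) x l", OF da db dc]])
      (simp only: det_3_scale_columns distrib_left)
qed

text \<open>The left side is the expansion of the determinant with columns \<open>f\<close>, \<open>a - x * b\<close> and
  \<open>b - x * c\<close>. Since \<open>b - x * c = - u * g\<close>, the multiple of \<open>g\<close> in \<open>a - x * b\<close> contributes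
  nothing; exchanging the last two columns cancels the sign, and transposing yields the right side.\<close>

lemma det_row_operations:
  fixes x u v s :: real and f g h a b c :: "'i \<Rightarrow> real"
  assumes b: "\<And>i. b i = x * c i - u * g i" and a: "\<And>i. a i = x * b i + v * (h i - s * g i)"
  shows "det (vector [vector [x\<^sup>2 * f i, b i, c i], vector [x\<^sup>2 * f j, b j, c j], vector [x\<^sup>2 * f k, b k, c k]] :: real ^ 3 ^ 3)
   + det (vector [vector [a i, x * f i, c i], vector [a j, x * f j, c j], vector [a k, x * f k, c k]] :: real ^ 3 ^ 3)
   + det (vector [vector [a i, b i, f i], vector [a j, b j, f j], vector [a k, b k, f k]] :: real ^ 3 ^ 3)
   = u * v * det (vector [vector [f i, f j, f k], vector [g i, g j, g k], vector [h i, h j, h k]] :: real ^ 3 ^ 3)"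
  unfolding det_3 vector_3 a b by algebra

theorem mainTheorem5:
  fixes n :: nat and x l1 l2 l3 :: real
  assumes "n \<ge> 3" and "x > 0" and "l1 \<ge> 0" and "l2 \<ge> 0" and "l3 \<ge> 0"
  shows "R3 n x l1 l2 l3 =
    (real n - 2) * x ^ (3 * n - 4) * exp (- 3 * x)
      / (real n * (real n - 1) ^ 2 * (real n - 2) ^ 3)
    * det (vector
        [vector [hyp0F1 (n - 2) (x * l1), hyp0F1 (n - 2) (x * l2), hyp0F1 (n - 2) (x * l3)],
         vector [G2 (n - 1) x l1, G2 (n - 1) x l2, G2 (n - 1) x l3],
         vector [G3 n x l1, G3 n x l2, G3 n x l3]] :: real ^ 3 ^ 3)"
proof -
  define m where "m = n - 3"
  have n: "n = Suc (Suc (Suc m))"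
    using assms(1) by (simp add: m_def)
  define k l where "k = x ^ Suc (Suc m) * exp (- x) / (real (Suc m) * real (Suc (Suc m)))"
    and "l = x ^ Suc (Suc (Suc m)) * exp (- x) / (real (Suc m) * real (Suc (Suc m)) * real (Suc (Suc (Suc m))))"
  have "H (Suc m) (Suc m) x y = x * H m (Suc m) x y - k * G2 (Suc (Suc m)) x y"
    and "H (Suc (Suc m)) (Suc m) x y = x * H (Suc m) (Suc m) x y
      + l * (G3 n x y - real n * G2 (Suc (Suc m)) x y)" for y
    using H_combination_G2[OF assms(2), of m y] H_combination_G3[OF assms(2), of m y]
    unfolding k_def[symmetric] l_def[symmetric] n by linarith+
  note det_row_operations[of "\<lambda>y. H (Suc m) (Suc m) x y" x "\<lambda>y. H m (Suc m) x y" k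
      "\<lambda>y. G2 (Suc (Suc m)) x y" "\<lambda>y. H (Suc (Suc m)) (Suc m) x y" l
      "\<lambda>y. G3 n x y" "real n" "\<lambda>y. hyp0F1 (Suc m) (x * y)" l1 l2 l3, OF this]
  then have R: "R3 n x l1 l2 l3 = x ^ m * exp (- x) * (k * l) * det (vector
        [vector [hyp0F1 (n - 2) (x * l1), hyp0F1 (n - 2) (x * l2), hyp0F1 (n - 2) (x * l3)],
         vector [G2 (n - 1) x l1, G2 (n - 1) x l2, G2 (n - 1) x l3],
         vector [G3 n x l1, G3 n x l2, G3 n x l3]] :: real ^ 3 ^ 3)"
    using R3_eq_sum_det[OF assms(2), of m l1 l2 l3] unfolding Let_def by (simp add: n)
  have pw: "x ^ m * x ^ Suc (Suc m) * x ^ Suc (Suc (Suc m)) = x ^ (3 * n - 4)"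
    unfolding n power_add[symmetric] by (rule arg_cong[where f = "power x"]) simp
  have ex: "exp (- x) * exp (- x) * exp (- x) = exp (- 3 * x)"
    by (simp flip: exp_add)
  have "x ^ m * exp (- x) * (k * l) = x ^ (3 * n - 4) * exp (- 3 * x)
      / ((real (Suc m) * real (Suc (Suc m))) * (real (Suc m) * real (Suc (Suc m)) * real (Suc (Suc (Suc m)))))"
    unfolding k_def l_def pw[symmetric] ex[symmetric]
    by (simp only: times_divide_eq_right times_divide_eq_left divide_divide_eq_left mult_ac)
  also have "\<dots> = (real n - 2) * x ^ (3 * n - 4) * exp (- 3 * x)
      / (real n * (real n - 1) ^ 2 * (real n - 2) ^ 3)"
  proof -
    have r: "real (Suc m) = real n - 2" "real (Suc (Suc m)) = real n - 1" "real (Suc (Suc (Suc m))) = real n"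
      by (simp_all add: n)
    have "real n - 2 \<noteq> 0" "real n - 1 \<noteq> 0" "real n \<noteq> 0" using assms(1) by auto
    then show ?thesis
      unfolding r by (simp add: divide_simps power2_eq_square power3_eq_cube)
  qed
  finally show ?thesis unfolding R by simp
qed

end
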